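(* Let $\mathcal{X}$ be an infinite-dimensional real Banach space, let $S$ be a closed partial complex structure on $\mathcal{X}$, and let $\mathcal{A}=\mathcal{A}_S=\{T\in\mathcal{B}(\mathcal{X}): TS\subset ST\}$. Then the set $\mathcal{A}^F$ of all finite rank operators in $\mathcal{A}$ is dense in $\mathcal{A}$ with respect to the strong operator topology.
   Context: $\mathcal{B}(\mathcal{X})$ is the algebra of all bounded linear operators on $\mathcal{X}$. A partial complex structure on $\mathcal{X}$ is a linear operator $S$ defined on a dense linear subspace $\mathcal{D}(S)\subset\mathcal{X}$, taking values in $\mathcal{X}$, such that $S^{-1}=-S$ (so $S\mathcal{D}(S)=\mathcal{D}(S)$ and $S^2x=-x$ for $x\in\mathcal{D}(S)$); it is closed if it is a closed operator. $TS\subset ST$ means that for all $x\in\mathcal{D}(S)$ one has $Tx\in\mathcal{D}(S)$ and $TSx=STx$. *)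

theory Defs
  imports "HOL-Analysis.Analysis"
begin

text \<open>
  A partially defined operator is given by its domain \<open>D\<close> together with a total function \<open>S\<close>;
  every notion below depends only on the values of \<open>S\<close> on \<open>D\<close>.
\<close>

definition partial_linear_operator ::
    "'a::real_vector set \<Rightarrow> ('a \<Rightarrow> 'b::real_vector) \<Rightarrow> bool" where
  "partial_linear_operator D S \<longleftrightarrow>
     subspace D \<and>
     (\<forall>x\<in>D. \<forall>y\<in>D. S (x + y) = S x + S y) \<and>
     (\<forall>c. \<forall>x\<in>D. S (c *\<^sub>R x) = c *\<^sub>R S x)"

text \<open>
  The last three conjuncts say that \<open>S\<^sup>-\<^sup>1 = - S\<close> as an equality of partially defined operators:
  \<open>S\<close> is invertible, the domain \<open>S ` D\<close> of its inverse is \<open>D\<close>, and the two sides agree on \<open>D\<close>.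
\<close>

definition partial_complex_structure ::
    "'a::real_normed_vector set \<Rightarrow> ('a \<Rightarrow> 'a) \<Rightarrow> bool" where
  "partial_complex_structure D S \<longleftrightarrow>
     partial_linear_operator D S \<and>
     closure D = UNIV \<and>
     inj_on S D \<and>
     S ` D = D \<and>
     (\<forall>x\<in>D. the_inv_into D S x = - S x)"

definition closed_operator ::
    "'a::real_normed_vector set \<Rightarrow> ('a \<Rightarrow> 'b::real_normed_vector) \<Rightarrow> bool" where
  "closed_operator D S \<longleftrightarrow> closed {(x, S x) |x. x \<in> D}"

definition commuting_operators ::
    "'a::real_normed_vector set \<Rightarrow> ('a \<Rightarrow> 'a) \<Rightarrow> ('a \<Rightarrow>\<^sub>L 'a) set" where
  "commuting_operators D S =
     {T. \<forall>x\<in>D. blinfun_apply T x \<in> D \<and> blinfun_apply T (S x) = S (blinfun_apply T x)}"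

text \<open>
  The library function \<open>dim\<close> is \<open>0\<close> on infinite-dimensional spaces, hence the explicit
  finite spanning set.
\<close>

definition finite_dimensional :: "'a::real_vector set \<Rightarrow> bool" where
  "finite_dimensional V \<longleftrightarrow> (\<exists>B. finite B \<and> span B = V)"

definition finite_rank ::
    "('a::real_normed_vector \<Rightarrow>\<^sub>L 'b::real_normed_vector) \<Rightarrow> bool" where
  "finite_rank T \<longleftrightarrow> finite_dimensional (range (blinfun_apply T))"

definition dense_in_topology :: "'a topology \<Rightarrow> 'a set \<Rightarrow> bool" where
  "dense_in_topology X U \<longleftrightarrow> U \<subseteq> topspace X \<and> X closure_of U = topspace X"

end

theory Submission
  imports Defs
begin

text \<open>
  Commuting operators of finite rank come from functionals on \<open>X \<times> X\<close>: if \<open>L\<close> is bounded and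
  vanishes on the graph of \<open>S\<close>, then \<open>x \<mapsto> L (0, x) u + L (x, 0) S u\<close> with \<open>u \<in> D\<close> commutes with
  \<open>S\<close> (lemma \<open>annihilator_operator\<close>). In other words \<open>h = L (0, \<cdot>)\<close> lies in the domain of the
  adjoint of \<open>S\<close> and \<open>- L (\<cdot>, 0)\<close> is the image of \<open>h\<close> under the adjoint. As the graph is closed,
  the Hahn-Banach theorem supplies a functional \<open>L\<close> that is nonzero at any given pair outside it.

  Given \<open>T\<close> in the algebra, finitely many points \<open>B\<close> and a tolerance, an approximating \<open>F\<close> is built
  by adding the points one at a time (lemma \<open>finite_rank_approximation\<close>). The obstacle is that a
  new point may have the form \<open>x = b + S d\<close> with \<open>b, d\<close> in the span of the old points and \<open>d \<in> D\<close>;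
  then \<open>F x = F b + S (F d)\<close> is already determined, and since \<open>S\<close> may be unbounded, \<open>F d\<close> being close to
  \<open>T d\<close> says nothing about \<open>F x\<close>. The induction therefore carries the stronger claim that \<open>F\<close>
  equals \<open>T\<close> on \<open>D \<inter> span B\<close>. This is possible because \<open>T\<close> maps \<open>D\<close> into \<open>D\<close>, and values
  in \<open>D\<close> can be attained exactly.

  If \<open>x\<close> is not of that form, then \<open>(0, x)\<close> is outside the sum of the graph and a
  finite-dimensional space containing \<open>(b, 0)\<close> and \<open>(0, b)\<close> for all old points \<open>b\<close>. That sum is
  closed, so some \<open>L\<close> separates \<open>(0, x)\<close> from it, and the corresponding operator kills the old
  points while it takes a prescribed value of \<open>D\<close> at \<open>x\<close> (lemma \<open>operator_prescribed_at_point\<close>).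
  Adding it to the previous \<open>F\<close> corrects the value at \<open>x\<close> and leaves those at the old points.
\<close>

section \<open>Separating a point from a closed subspace\<close>

definition sublinear :: "('a::real_vector \<Rightarrow> real) \<Rightarrow> bool" where
  "sublinear p \<longleftrightarrow>
     (\<forall>x y. p (x + y) \<le> p x + p y) \<and> (\<forall>c\<ge>0. \<forall>x. p (c *\<^sub>R x) = c * p x)"

lemma sublinear_add: "sublinear p \<Longrightarrow> p (x + y) \<le> p x + p y"
  and sublinear_scale: "sublinear p \<Longrightarrow> 0 \<le> c \<Longrightarrow> p (c *\<^sub>R x) = c * p x"
  by (auto simp: sublinear_def)

lemma sublinear_zero: "sublinear p \<Longrightarrow> p 0 = 0"
  using sublinear_scale[of p 0 0] by simp

lemma sublinear_ge_neg: "sublinear p \<Longrightarrow> - p (- x) \<le> p x"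
  using sublinear_add[of p x "- x"] sublinear_zero[of p] by simp

lemma sublinearI:
  assumes "\<And>x y. p (x + y) \<le> p x + p y" and "p 0 = 0"
    and le: "\<And>c x. 0 < c \<Longrightarrow> p (c *\<^sub>R x) \<le> c * p x"
  shows "sublinear p"
proof -
  have "p (c *\<^sub>R x) = c * p x" if "0 < c" for c x
  proof (rule antisym[OF le[OF that]])
    have "p ((1/c) *\<^sub>R c *\<^sub>R x) \<le> (1/c) * p (c *\<^sub>R x)"
      using that by (intro le) simp
    then show "c * p x \<le> p (c *\<^sub>R x)"
      using that by (simp add: field_simps)
  qed
  then show ?thesis
    using assms(1,2) unfolding sublinear_def by (metis mult_zero_left order_le_less scaleR_zero_left)
qed

text \<open>
  The infimum over \<open>t \<ge> 0\<close> of \<open>p (x + t v) - t p v\<close> is sublinear because the parameters of two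
  points add up, and it is finite because each term is at least \<open>- p (- x)\<close>. A linear functional below it is
  forced to be at least \<open>p v\<close> at \<open>v\<close>.
\<close>

lemma sublinear_lower_along:
  fixes p :: "'a::real_vector \<Rightarrow> real"
  assumes p: "sublinear p"
  obtains q where "sublinear q" "q \<le> p" "q (- v) \<le> - p v"
proof
  define q where "q x = (INF t\<in>{0..}. p (x + t *\<^sub>R v) - t * p v)" for x
  have lower: "- p (- x) \<le> p (x + t *\<^sub>R v) - t * p v" if "0 \<le> t" for x t
    using sublinear_add[OF p, of "x + t *\<^sub>R v" "- x"] sublinear_scale[OF p that, of v] by simp
  have bdd: "bdd_below ((\<lambda>t. p (x + t *\<^sub>R v) - t * p v) ` {0..})" for x
    using lower[of _ x] by (intro bdd_belowI2[where m = "- p (- x)"]) auto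
  have q_le: "q x \<le> p (x + t *\<^sub>R v) - t * p v" if "0 \<le> t" for x t
    unfolding q_def using bdd that by (intro cINF_lower) auto
  have q_ge: "m \<le> q x" if "\<And>t. 0 \<le> t \<Longrightarrow> m \<le> p (x + t *\<^sub>R v) - t * p v" for m x
    unfolding q_def using that by (intro cINF_greatest) auto
  show "sublinear q"
  proof (rule sublinearI)
    fix x y
    have step: "q (x + y) - (p (x + s *\<^sub>R v) - s * p v) \<le> p (y + t *\<^sub>R v) - t * p v"
      if "0 \<le> s" "0 \<le> t" for s t
      using q_le[of "s + t" "x + y"] that sublinear_add[OF p, of "x + s *\<^sub>R v" "y + t *\<^sub>R v"]
      by (simp add: algebra_simps)
    have "q (x + y) - (p (x + s *\<^sub>R v) - s * p v) \<le> q y" if "0 \<le> s" for s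
      using step that by (intro q_ge) auto
    then have "q (x + y) - q y \<le> q x"
      by (intro q_ge) (smt (verit))
    then show "q (x + y) \<le> q x + q y" by simp
  next
    show "q 0 = 0"
      using q_le[of 0 0] q_ge[of 0 0] sublinear_scale[OF p] sublinear_zero[OF p] by fastforce
  next
    fix c :: real and x assume c: "0 < c"
    have "q (c *\<^sub>R x) / c \<le> p (x + t *\<^sub>R v) - t * p v" if "0 \<le> t" for t
    proof -
      have "q (c *\<^sub>R x) \<le> p (c *\<^sub>R (x + t *\<^sub>R v)) - (c * t) * p v"
        using q_le[of "c * t" "c *\<^sub>R x"] c that by (simp add: scaleR_add_right)
      then show ?thesis
        using c sublinear_scale[OF p, of c "x + t *\<^sub>R v"] by (simp add: field_simps)
    qed
    then have "q (c *\<^sub>R x) / c \<le> q x" by (rule q_ge)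
    then show "q (c *\<^sub>R x) \<le> c * q x" using c by (simp add: field_simps)
  qed
  show "q \<le> p" using q_le[of 0] by (auto simp: le_fun_def)
  show "q (- v) \<le> - p v" using q_le[of 1 "- v"] sublinear_zero[OF p] by simp
qed

text \<open>
  Zorn's lemma applies since the pointwise infimum of a chain is again sublinear: for \<open>q, r\<close> in the
  chain the smaller of the two bounds the value at \<open>x + y\<close> by \<open>q x + r y\<close>.
\<close>

lemma exists_minimal_sublinear:
  fixes p :: "'a::real_vector \<Rightarrow> real"
  assumes p: "sublinear p"
  obtains q where "sublinear q" "q \<le> p" "\<And>r. sublinear r \<Longrightarrow> r \<le> q \<Longrightarrow> r = q"
proof -
  define A where "A = {q. sublinear q \<and> q \<le> p}"
  define P :: "('a \<Rightarrow> real) \<Rightarrow> ('a \<Rightarrow> real) \<Rightarrow> bool" where "P q r \<longleftrightarrow> r \<le> q" for q r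
  have "\<exists>m\<in>A. \<forall>a\<in>A. P m a \<longrightarrow> a = m"
  proof (rule predicate_Zorn)
    show "partial_order_on A (relation_of P A)"
      by (rule partial_order_on_relation_ofI) (auto simp: P_def)
  next
    fix C assume "C \<in> Chains (relation_of P A)"
    then have CA: "C \<subseteq> A" and total: "\<And>q r. q \<in> C \<Longrightarrow> r \<in> C \<Longrightarrow> q \<le> r \<or> r \<le> q"
      by (auto simp: Chains_def relation_of_def P_def)
    show "\<exists>u\<in>A. \<forall>a\<in>C. P a u"
    proof (cases "C = {}")
      case True
      then show ?thesis using p by (auto simp: A_def)
    next
      case False
      define u where "u x = (INF q\<in>C. q x)" for x
      have bdd: "bdd_below ((\<lambda>q. q x) ` C)" for x
      proof (rule bdd_belowI2[where m = "- p (- x)"])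
        fix q assume "q \<in> C"
        then have "sublinear q" "q (- x) \<le> p (- x)" using CA by (auto simp: A_def le_fun_def)
        then show "- p (- x) \<le> q x" using sublinear_ge_neg[of q x] by simp
      qed
      have u_le: "u x \<le> q x" if "q \<in> C" for q x
        unfolding u_def using bdd that by (intro cINF_lower) auto
      have u_ge: "m \<le> u x" if "\<And>q. q \<in> C \<Longrightarrow> m \<le> q x" for m x
        unfolding u_def using that False by (intro cINF_greatest) auto
      have sub: "sublinear q" if "q \<in> C" for q using CA that by (auto simp: A_def)
      have "sublinear u"
      proof (rule sublinearI)
        fix x y
        have step: "u (x + y) - q x \<le> r y" if "q \<in> C" "r \<in> C" for q r
        proof (rule disjE[OF total[OF that]])
          assume "q \<le> r"
          then have "q y \<le> r y" by (simp add: le_fun_def)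
          then show ?thesis
            using u_le[OF that(1), of "x + y"] sublinear_add[OF sub[OF that(1)], of x y] by simp
        next
          assume "r \<le> q"
          then have "r x \<le> q x" by (simp add: le_fun_def)
          then show ?thesis
            using u_le[OF that(2), of "x + y"] sublinear_add[OF sub[OF that(2)], of x y] by simp
        qed
        have "u (x + y) - q x \<le> u y" if "q \<in> C" for q
          using step that by (intro u_ge) auto
        then have "u (x + y) - u y \<le> u x"
          by (intro u_ge) (smt (verit))
        then show "u (x + y) \<le> u x + u y" by simp
      next
        show "u 0 = 0" using False sub by (simp add: u_def sublinear_zero)
      next
        fix c :: real and x assume c: "0 < c"
        have "u (c *\<^sub>R x) / c \<le> q x" if "q \<in> C" for q
          using u_le[OF that, of "c *\<^sub>R x"] sublinear_scale[OF sub[OF that], of c x] c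
          by (simp add: field_simps)
        then have "u (c *\<^sub>R x) / c \<le> u x" by (rule u_ge)
        then show "u (c *\<^sub>R x) \<le> c * u x" using c by (simp add: field_simps)
      qed
      moreover have "u \<le> p"
        using False u_le CA unfolding A_def le_fun_def by (smt (verit) ex_in_conv mem_Collect_eq subsetD)
      ultimately show ?thesis using u_le by (auto simp: A_def P_def le_fun_def)
    qed
  qed
  then show thesis
    using that unfolding A_def P_def by (metis (mono_tags, lifting) mem_Collect_eq order_trans)
qed

text \<open>
  By minimality, lowering \<open>q\<close> along \<open>v\<close> does not change it, so \<open>q (- v) \<le> - q v\<close>. Thus \<open>q\<close> is
  odd, and an odd subadditive functional is also superadditive.
\<close>

lemma minimal_sublinear_linear:
  fixes q :: "'a::real_vector \<Rightarrow> real"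
  assumes q: "sublinear q" and minimal: "\<And>r. sublinear r \<Longrightarrow> r \<le> q \<Longrightarrow> r = q"
  shows "linear q"
proof -
  have odd: "q (- v) = - q v" for v
  proof (rule antisym)
    show "q (- v) \<le> - q v"
      using sublinear_lower_along[OF q, of v] minimal by metis
    show "- q v \<le> q (- v)" using sublinear_ge_neg[OF q, of "- v"] by simp
  qed
  show ?thesis
  proof (rule linearI)
    fix x y
    have "q (- x + - y) \<le> q (- x) + q (- y)" by (rule sublinear_add[OF q])
    then have "q x + q y \<le> q (x + y)" using odd[of "x + y"] by (simp add: odd)
    then show "q (x + y) = q x + q y" using sublinear_add[OF q, of x y] by simp
  next
    fix c :: real and x
    show "q (c *\<^sub>R x) = c *\<^sub>R q x"
    proof (cases "0 \<le> c")
      case True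
      then show ?thesis by (simp add: sublinear_scale[OF q])
    next
      case False
      then have "q (- ((- c) *\<^sub>R x)) = c * q x"
        unfolding odd by (subst sublinear_scale[OF q]) auto
      then show ?thesis by simp
    qed
  qed
qed

text \<open>
  A minimal functional is taken below the one lowered along \<open>v\<close>, which forces equality at \<open>v\<close>.
\<close>

theorem Hahn_Banach_sublinear:
  fixes p :: "'a::real_vector \<Rightarrow> real"
  assumes "sublinear p"
  obtains f where "linear f" "\<And>x. f x \<le> p x" "f v = p v"
proof -
  obtain r where r: "sublinear r" "r \<le> p" "r (- v) \<le> - p v"
    using sublinear_lower_along[OF assms] .
  obtain f where f: "sublinear f" "f \<le> r" "\<And>q. sublinear q \<Longrightarrow> q \<le> f \<Longrightarrow> q = f"
    using exists_minimal_sublinear[OF r(1)] by metis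
  have lin: "linear f" by (rule minimal_sublinear_linear[OF f(1) f(3)])
  have le: "f x \<le> p x" for x using f(2) r(2) by (meson le_funD order_trans)
  have "- f v \<le> - p v"
    using le_funD[OF f(2), of "- v"] r(3) linear_neg[OF lin, of v] by simp
  then have "f v = p v" using le[of v] by simp
  then show thesis using that lin le by blast
qed

lemma sublinear_infdist_subspace:
  fixes V :: "'a::real_normed_vector set"
  assumes V: "subspace V"
  shows "sublinear (\<lambda>x. infdist x V)"
proof (rule sublinearI)
  have ne: "V \<noteq> {}" using subspace_0[OF V] by auto
  have ge: "m \<le> infdist x V" if "\<And>a. a \<in> V \<Longrightarrow> m \<le> dist x a" for m x
    unfolding infdist_notempty[OF ne] using that ne by (intro cINF_greatest) auto
  show "infdist (x + y) V \<le> infdist x V + infdist y V" for x y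
  proof -
    have step: "infdist (x + y) V - dist x a \<le> dist y b" if "a \<in> V" "b \<in> V" for a b
    proof -
      have "infdist (x + y) V \<le> dist (x + y) (a + b)"
        using subspace_add[OF V] that by (intro infdist_le) auto
      also have "\<dots> \<le> dist x a + dist y b"
        by (rule dist_triangle_add)
      finally show ?thesis by simp
    qed
    have "infdist (x + y) V - dist x a \<le> infdist y V" if "a \<in> V" for a
      using step that by (intro ge) auto
    then have "infdist (x + y) V - infdist y V \<le> infdist x V"
      by (intro ge) (smt (verit))
    then show ?thesis by simp
  qed
  show "infdist 0 V = 0" using subspace_0[OF V] by simp
  fix c :: real and x :: 'a assume c: "0 < c"
  have "infdist (c *\<^sub>R x) V / c \<le> dist x a" if "a \<in> V" for a
  proof -
    have "infdist (c *\<^sub>R x) V \<le> dist (c *\<^sub>R x) (c *\<^sub>R a)"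
      using subspace_scale[OF V] that by (intro infdist_le) auto
    also have "\<dots> = c * dist x a"
      using c norm_scaleR[of c "x - a"] by (simp add: dist_norm scaleR_diff_right)
    finally show ?thesis using c by (simp add: field_simps)
  qed
  then have "infdist (c *\<^sub>R x) V / c \<le> infdist x V" by (rule ge)
  then show "infdist (c *\<^sub>R x) V \<le> c * infdist x V" using c by (simp add: field_simps)
qed

text \<open>
  The functional is dominated by the distance to \<open>V\<close>. This seminorm vanishes exactly on \<open>V\<close> because
  \<open>V\<close> is closed, and it is at most the norm, which makes the functional bounded.
\<close>

theorem separate_point_closed_subspace:
  fixes V :: "'a::real_normed_vector set"
  assumes V: "subspace V" "closed V" and v: "v \<notin> V"
  obtains f :: "'a \<Rightarrow> real" where "bounded_linear f" "\<And>x. x \<in> V \<Longrightarrow> f x = 0" "f v = 1"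
proof -
  have ne: "V \<noteq> {}" using subspace_0[OF V(1)] by auto
  have pos: "0 < infdist v V" by (rule infdist_pos_not_in_closed[OF V(2) ne v])
  obtain g where g: "linear g" "\<And>x. g x \<le> infdist x V" "g v = infdist v V"
    using Hahn_Banach_sublinear[OF sublinear_infdist_subspace[OF V(1)], of v] by metis
  have g_abs: "\<bar>g x\<bar> \<le> infdist x V" for x
  proof -
    have "infdist (- x) V \<le> infdist x V"
    proof -
      have "infdist (- x) V \<le> dist x a" if "a \<in> V" for a
        using infdist_le[of "- a" V "- x"] subspace_neg[OF V(1) that] by (simp add: dist_minus)
      then show ?thesis unfolding infdist_notempty[OF ne, of x] using ne by (intro cINF_greatest) auto
    qed
    then show ?thesis
      using g(2)[of x] g(2)[of "- x"] linear_neg[OF g(1), of x] by simp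
  qed
  have bl: "bounded_linear g"
  proof (rule bounded_linear_intro[where K = 1])
    show "norm (g x) \<le> norm x * 1" for x
      using g_abs[of x] infdist_le[OF subspace_0[OF V(1)], of x] by simp
  qed (use g(1) in \<open>auto simp: linear_add linear_scale\<close>)
  show thesis
  proof (rule that[of "\<lambda>x. g x / infdist v V"])
    show "bounded_linear (\<lambda>x. g x / infdist v V)"
      using bounded_linear_compose[OF bounded_linear_divide bl] .
    show "g x / infdist v V = 0" if "x \<in> V" for x using g_abs[of x] that by simp
    show "g v / infdist v V = 1" using g(3) pos by simp
  qed
qed

text \<open>
  With \<open>f\<close> vanishing on \<open>V\<close> and \<open>f v = 1\<close>, the component of \<open>y\<close> along \<open>v\<close> can only be \<open>f y\<close>, so the
  span is the preimage of \<open>V\<close> under the continuous map \<open>y \<mapsto> y - f y v\<close>.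
\<close>

lemma closed_span_insert:
  fixes V :: "'a::real_normed_vector set"
  assumes V: "subspace V" "closed V"
  shows "closed (span (insert v V))"
proof (cases "v \<in> V")
  case True
  then show ?thesis using V by (simp add: insert_absorb span_eq_iff[THEN iffD2])
next
  case False
  obtain f :: "'a \<Rightarrow> real" where f: "bounded_linear f" "\<And>x. x \<in> V \<Longrightarrow> f x = 0" "f v = 1"
    using separate_point_closed_subspace[OF V False] by metis
  interpret f: bounded_linear f by fact
  have "span (insert v V) = (\<lambda>y. y - f y *\<^sub>R v) -` V"
  proof (intro set_eqI iffI)
    fix y assume "y \<in> span (insert v V)"
    then obtain k where k: "y - k *\<^sub>R v \<in> V"
      using V(1) by (auto simp: span_breakdown_eq span_eq_iff[THEN iffD2])
    then have "f y = k" using f(2)[OF k] f(3) by (simp add: f.diff f.scaleR)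
    then show "y \<in> (\<lambda>y. y - f y *\<^sub>R v) -` V" using k by simp
  next
    fix y assume "y \<in> (\<lambda>y. y - f y *\<^sub>R v) -` V"
    then show "y \<in> span (insert v V)"
      by (auto simp: span_breakdown_eq intro!: exI[of _ "f y"] span_base)
  qed
  moreover have "continuous_on UNIV (\<lambda>y. y - f y *\<^sub>R v)"
    by (intro continuous_intros f.continuous_on)
  ultimately show ?thesis using V(2) by (simp add: continuous_closed_vimage continuous_on_eq_continuous_at)
qed

lemma closed_span_Un_finite:
  fixes V :: "'a::real_normed_vector set"
  assumes V: "subspace V" "closed V" and "finite C"
  shows "closed (span (V \<union> C))"
  using \<open>finite C\<close>
proof induction
  case empty
  then show ?case using V by (simp add: span_eq_iff[THEN iffD2])
next
  case (insert c C)
  have "span (insert c (span (V \<union> C))) = span (V \<union> insert c C)"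
    by (simp add: span_insert span_span)
  then show ?case using closed_span_insert[OF subspace_span insert.IH] by metis
qed

section \<open>Neighbourhoods in the strong operator topology and operators of finite rank\<close>

lemma strong_operator_neighbourhood:
  fixes T :: "'a::real_normed_vector \<Rightarrow>\<^sub>L 'b::real_normed_vector"
  assumes "openin strong_operator_topology U" "T \<in> U"
  obtains B e where "finite B" "0 < e"
    "\<And>F. (\<And>b. b \<in> B \<Longrightarrow> norm (blinfun_apply F b - blinfun_apply T b) < e) \<Longrightarrow> F \<in> U"
proof -
  obtain W where W: "open W" "U = blinfun_apply -` W"
    using assms(1) by (auto simp: strong_operator_topology_def openin_pullback_topology)
  have "\<exists>X. blinfun_apply T \<in> Pi\<^sub>E UNIV X \<and> (\<forall>i. openin euclidean (X i)) \<and>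
      finite {i. X i \<noteq> topspace euclidean} \<and> Pi\<^sub>E UNIV X \<subseteq> W"
    by (rule product_topology_open_contains_basis)
       (use W assms(2) in \<open>auto simp: open_fun_def\<close>)
  then obtain X where X: "\<And>i. T i \<in> X i" "\<And>i. open (X i)" "finite {i. X i \<noteq> UNIV}"
      "Pi\<^sub>E UNIV X \<subseteq> W"
    by (auto simp: PiE_iff)
  obtain r where r: "\<And>i. 0 < r i" "\<And>i. ball (T i) (r i) \<subseteq> X i"
  proof -
    have "\<exists>d>0. ball (T i) d \<subseteq> X i" for i
      using X(1,2) open_contains_ball by blast
    then show thesis using that by metis
  qed
  define B where "B = {i. X i \<noteq> UNIV}"
  define e where "e = Min (insert 1 (r ` B))"
  have fin: "finite B" using X(3) by (simp add: B_def)
  have "0 < e" using fin r(1) by (auto simp: e_def)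
  moreover have "F \<in> U" if "\<And>b. b \<in> B \<Longrightarrow> norm (blinfun_apply F b - blinfun_apply T b) < e" for F
  proof -
    have "blinfun_apply F i \<in> X i" for i
    proof (cases "i \<in> B")
      case True
      then have "e \<le> r i" using fin by (auto simp: e_def)
      then have "blinfun_apply F i \<in> ball (T i) (r i)" using that[OF True] by (simp add: dist_norm norm_minus_commute)
      then show ?thesis using r(2) by blast
    qed (simp add: B_def)
    then show ?thesis using X(4) W(2) by auto
  qed
  ultimately show thesis using that fin by blast
qed

text \<open>
  The sum of the absolute values of the coefficients of \<open>y\<close> serves as \<open>K\<close>. It is the same for all
  linear maps, so a tolerance on \<open>B\<close> that suits \<open>y\<close> can be fixed before the map is chosen.
\<close>

lemma linear_bound_on_span:
  fixes y :: "'a::real_vector"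
  assumes "y \<in> span B"
  obtains K where "0 \<le> K"
    "\<And>(f :: 'a \<Rightarrow> 'b::real_normed_vector) e. linear f \<Longrightarrow> (\<And>b. b \<in> B \<Longrightarrow> norm (f b) \<le> e) \<Longrightarrow> norm (f y) \<le> K * e"
proof -
  have "\<exists>K\<ge>0. \<forall>(f :: 'a \<Rightarrow> 'b) e. linear f \<longrightarrow> (\<forall>b\<in>B. norm (f b) \<le> e) \<longrightarrow> norm (f y) \<le> K * e"
    using assms
  proof (induction rule: span_induct_alt)
    case base
    then show ?case by (auto simp: linear_0 intro!: exI[of _ 0])
  next
    case (step c x y)
    then obtain K where K: "0 \<le> K"
      "\<And>(f :: 'a \<Rightarrow> 'b) e. linear f \<Longrightarrow> \<forall>b\<in>B. norm (f b) \<le> e \<Longrightarrow> norm (f y) \<le> K * e" by blast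
    have "norm (f (c *\<^sub>R x + y)) \<le> (\<bar>c\<bar> + K) * e"
      if f: "linear f" "\<forall>b\<in>B. norm (f b) \<le> e" for f :: "'a \<Rightarrow> 'b" and e
    proof -
      have "norm (f (c *\<^sub>R x + y)) \<le> \<bar>c\<bar> * norm (f x) + norm (f y)"
        using norm_triangle_ineq[of "c *\<^sub>R f x" "f y"] f(1) by (simp add: linear_add linear_scale)
      also have "\<dots> \<le> \<bar>c\<bar> * e + K * e"
        using f step(1) K(2)[OF f] by (intro add_mono mult_left_mono) auto
      finally show ?thesis by (simp add: algebra_simps)
    qed
    then show ?case using K(1) by (intro exI[of _ "\<bar>c\<bar> + K"]) auto
  qed
  then show thesis using that by blast
qed

text \<open>
  Bounding the range by a finite-dimensional space is enough, which is easier to verify for sums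
  than exhibiting a finite set that spans the range.
\<close>

lemma finite_rank_iff_range_subset_span:
  "finite_rank F \<longleftrightarrow> (\<exists>B. finite B \<and> range (blinfun_apply F) \<subseteq> span B)"
proof
  assume "\<exists>B. finite B \<and> range (blinfun_apply F) \<subseteq> span B"
  then obtain B where B: "finite B" "range (blinfun_apply F) \<subseteq> span B" by blast
  obtain C where C: "C \<subseteq> range (blinfun_apply F)" "independent C" "range (blinfun_apply F) \<subseteq> span C"
    using maximal_independent_subset by blast
  have "finite C" using independent_span_bound[OF B(1) C(2)] C(1) B(2) by auto
  moreover have "subspace (range (blinfun_apply F))"
    by (intro linear_subspace_image bounded_linear.linear blinfun.bounded_linear_right subspace_UNIV)
  then have "span C = range (blinfun_apply F)" using C by (intro span_subspace) auto
  ultimately show "finite_rank F" unfolding finite_rank_def finite_dimensional_def by blast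
qed (auto simp: finite_rank_def finite_dimensional_def)

lemma finite_rank_zero: "finite_rank 0"
  unfolding finite_rank_iff_range_subset_span by (intro exI[of _ "{}"]) auto

lemma finite_rank_add:
  assumes "finite_rank F" "finite_rank G"
  shows "finite_rank (F + G)"
proof -
  obtain B C where "finite B" "range (blinfun_apply F) \<subseteq> span B"
    "finite C" "range (blinfun_apply G) \<subseteq> span C"
    using assms unfolding finite_rank_iff_range_subset_span by blast
  then have "finite (B \<union> C)" "range (blinfun_apply (F + G)) \<subseteq> span (B \<union> C)"
    using span_mono[of B "B \<union> C"] span_mono[of C "B \<union> C"]
    by (auto simp: blinfun.add_left image_subset_iff intro!: span_add)
  then show ?thesis unfolding finite_rank_iff_range_subset_span by blast
qed

section \<open>Finite rank operators commuting with a closed partial complex structure\<close>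

locale closed_partial_complex_structure =
  fixes D :: "'a::real_normed_vector set" and S :: "'a \<Rightarrow> 'a"
  assumes D_subspace: "subspace D"
    and S_add: "x \<in> D \<Longrightarrow> y \<in> D \<Longrightarrow> S (x + y) = S x + S y"
    and S_scaleR: "x \<in> D \<Longrightarrow> S (c *\<^sub>R x) = c *\<^sub>R S x"
    and D_dense: "closure D = UNIV"
    and S_in_D: "x \<in> D \<Longrightarrow> S x \<in> D"
    and S_S: "x \<in> D \<Longrightarrow> S (S x) = - x"
    and graph_closed: "closed ((\<lambda>x. (x, S x)) ` D)"
begin

lemma S_minus: "x \<in> D \<Longrightarrow> S (- x) = - S x"
  using S_scaleR[of x "- 1"] by simp

lemma subspace_graph: "subspace ((\<lambda>x. (x, S x)) ` D)"
proof (rule subspaceI)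
  show "0 \<in> (\<lambda>x. (x, S x)) ` D"
    using subspace_0[OF D_subspace] S_scaleR[of 0 0] by (auto simp: zero_prod_def image_iff)
qed (use subspace_add[OF D_subspace] subspace_scale[OF D_subspace] S_add S_scaleR in
      \<open>fastforce simp: image_iff\<close>)+

text \<open>
  Applying \<open>L = 0\<close> to the graph points of \<open>x\<close> and of \<open>S x\<close> gives \<open>L (0, S x) = - L (x, 0)\<close> and
  \<open>L (S x, 0) = L (0, x)\<close>: passing from \<open>x\<close> to \<open>S x\<close> acts on the two coefficients like
  multiplication by the imaginary unit.
\<close>

lemma annihilator_operator:
  fixes L :: "'a \<times> 'a \<Rightarrow> real"
  assumes L: "bounded_linear L" "\<And>x. x \<in> D \<Longrightarrow> L (x, S x) = 0" and u: "u \<in> D"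
  obtains F where "F \<in> commuting_operators D S" "finite_rank F"
    "\<And>x. F x = L (0, x) *\<^sub>R u + L (x, 0) *\<^sub>R S u"
proof -
  interpret L: bounded_linear L by fact
  define f where "f x = L (0, x) *\<^sub>R u + L (x, 0) *\<^sub>R S u" for x
  have "bounded_linear f"
    unfolding f_def
    by (intro bounded_linear_add bounded_linear_compose[OF bounded_linear_scaleR_left]
        bounded_linear_compose[OF L(1)] bounded_linear_Pair bounded_linear_zero bounded_linear_ident)
  then have app: "blinfun_apply (Blinfun f) = f" by (rule bounded_linear_Blinfun_apply)
  have f_D: "f x \<in> D" for x
    unfolding f_def using u S_in_D D_subspace by (intro subspace_add subspace_scale)
  have f_S: "f (S x) = S (f x)" if x: "x \<in> D" for x
  proof -
    have split: "L (a, b) = L (a, 0) + L (0, b)" for a b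
      using L.add[of "(a, 0)" "(0, b)"] by simp
    have "L (0, S x) = - L (x, 0)" using L(2)[OF x] split[of x "S x"] by simp
    moreover have "L (S x, 0) = L (0, x)"
      using L(2)[OF S_in_D[OF x]] split[of "S x" "- x"] S_S[OF x] L.neg[of "(0, x)"] by simp
    moreover have "S (f x) = L (0, x) *\<^sub>R S u - L (x, 0) *\<^sub>R u"
      unfolding f_def using u S_in_D D_subspace
      by (simp add: S_add S_scaleR S_S subspace_scale)
    ultimately show ?thesis by (simp add: f_def)
  qed
  show thesis
  proof (rule that[of "Blinfun f"])
    show "Blinfun f \<in> commuting_operators D S"
      using f_D f_S by (simp add: commuting_operators_def app)
    have "range f \<subseteq> span {u, S u}"
      unfolding f_def by (intro image_subsetI span_add span_scale span_base) auto
    then show "finite_rank (Blinfun f)"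
      unfolding finite_rank_iff_range_subset_span app by (intro exI[of _ "{u, S u}"]) auto
    show "Blinfun f x = L (0, x) *\<^sub>R u + L (x, 0) *\<^sub>R S u" for x by (simp add: app f_def)
  qed
qed

text \<open>
  If \<open>(0, x)\<close> were \<open>(b + d, c + S d)\<close> with \<open>b, c\<close> in the span of \<open>B\<close>, then \<open>d = - b\<close> would lie in that
  span as well and \<open>x = c + S d\<close>, contrary to the assumption. So \<open>(0, x)\<close> can be separated from the
  closed subspace of all such pairs.
\<close>

lemma annihilating_functional:
  assumes B: "finite B"
    and x: "\<And>b d. b \<in> span B \<Longrightarrow> d \<in> D \<inter> span B \<Longrightarrow> x \<noteq> b + S d"
  obtains L :: "'a \<times> 'a \<Rightarrow> real" where "bounded_linear L" "\<And>y. y \<in> D \<Longrightarrow> L (y, S y) = 0"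
    "\<And>b. b \<in> B \<Longrightarrow> L (b, 0) = 0" "\<And>b. b \<in> B \<Longrightarrow> L (0, b) = 0" "L (0, x) = 1"
proof -
  let ?G = "(\<lambda>x. (x, S x)) ` D"
  define C where "C = (\<lambda>b. (b, 0::'a)) ` B \<union> (\<lambda>b. (0::'a, b)) ` B"
  have fin: "finite C" using B by (simp add: C_def)
  have "\<exists>b\<in>span B. \<exists>c\<in>span B. \<exists>d\<in>D. z = (b + d, c + S d)" if "z \<in> span (?G \<union> C)" for z
    using that
  proof (induction rule: span_induct_alt)
    case base
    have "S 0 = 0" using S_scaleR[of 0 0] subspace_0[OF D_subspace] by simp
    then show ?case using subspace_0[OF D_subspace] span_zero[of B]
      by (intro bexI[of _ 0]) (auto simp: zero_prod_def)
  next
    case (step k g z)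
    then obtain b c d where z: "b \<in> span B" "c \<in> span B" "d \<in> D" "z = (b + d, c + S d)"
      by blast
    consider y where "y \<in> D" "g = (y, S y)" | y where "y \<in> B" "g = (y, 0)"
      | y where "y \<in> B" "g = (0, y)"
      using step(1) by (auto simp: C_def)
    then show ?case
    proof cases
      case 1
      then show ?thesis
        using z D_subspace
        by (intro bexI[of _ b] bexI[of _ c] bexI[of _ "k *\<^sub>R y + d"])
           (auto simp: S_add S_scaleR subspace_add subspace_scale algebra_simps)
    next
      case 2
      then show ?thesis
        using z by (intro bexI[of _ "k *\<^sub>R y + b"] bexI[of _ c] bexI[of _ d])
           (auto intro: span_add span_scale span_base)
    next
      case 3
      then show ?thesis
        using z by (intro bexI[of _ b] bexI[of _ "k *\<^sub>R y + c"] bexI[of _ d])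
           (auto intro: span_add span_scale span_base)
    qed
  qed
  moreover have False if "b \<in> span B" "c \<in> span B" "d \<in> D" "(0, x) = (b + d, c + S d)" for b c d
  proof -
    have "d = - b" using that(4) by (metis add.commute add_eq_0_iff prod.inject)
    then have "d \<in> D \<inter> span B" using that(1,3) span_neg by auto
    then show False using x[OF that(2)] that(4) by blast
  qed
  ultimately have notin: "(0, x) \<notin> span (?G \<union> C)" by blast
  obtain L where "bounded_linear L" "\<And>z. z \<in> span (?G \<union> C) \<Longrightarrow> L z = 0" "L (0, x) = (1::real)"
    using separate_point_closed_subspace[OF subspace_span
        closed_span_Un_finite[OF subspace_graph graph_closed fin] notin] by metis
  moreover have "(y, S y) \<in> span (?G \<union> C)" if "y \<in> D" for y
    using that by (intro span_base) auto
  moreover have "(b, 0) \<in> span (?G \<union> C)" "(0, b) \<in> span (?G \<union> C)" if "b \<in> B" for b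
    using that by (auto simp: C_def intro: span_base)
  ultimately show thesis using that by blast
qed

text \<open>
  A separating \<open>L\<close> yields the operator with value \<open>u + c S u\<close> at \<open>x\<close>, where \<open>c = L (x, 0)\<close> is not under
  control. This does not matter: \<open>1 + c S\<close> is invertible on \<open>D\<close>, just as \<open>1 + c i\<close> is a nonzero
  complex number.
\<close>

lemma operator_prescribed_at_point:
  assumes B: "finite B"
    and x: "\<And>b d. b \<in> span B \<Longrightarrow> d \<in> D \<inter> span B \<Longrightarrow> x \<noteq> b + S d"
    and w: "w \<in> D"
  obtains F where "F \<in> commuting_operators D S" "finite_rank F" "F x = w"
    "\<And>b. b \<in> span B \<Longrightarrow> F b = 0"
proof -
  obtain L :: "'a \<times> 'a \<Rightarrow> real" where L: "bounded_linear L" "\<And>y. y \<in> D \<Longrightarrow> L (y, S y) = 0"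
    "\<And>b. b \<in> B \<Longrightarrow> L (b, 0) = 0" "\<And>b. b \<in> B \<Longrightarrow> L (0, b) = 0" "L (0, x) = 1"
    using annihilating_functional[OF B x] by metis
  define c where "c = L (x, 0)"
  \<comment> \<open>This is \<open>(1 + c S)\<close> inverted and applied to \<open>w\<close>; compare \<open>1 / (1 + c i) = (1 - c i) / (1 + c\<^sup>2)\<close>.\<close>
  define u where "u = (1 / (1 + c\<^sup>2)) *\<^sub>R (w - c *\<^sub>R S w)"
  have w': "w - c *\<^sub>R S w \<in> D"
    using w S_in_D D_subspace by (intro subspace_diff subspace_scale)
  then have u: "u \<in> D" unfolding u_def using D_subspace by (intro subspace_scale)
  have "S (w + (- c) *\<^sub>R S w) = S w + (- c) *\<^sub>R S (S w)"
    using w S_in_D[OF w] D_subspace by (subst S_add) (auto simp: S_scaleR S_minus subspace_scale subspace_neg)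
  then have "S u = (1 / (1 + c\<^sup>2)) *\<^sub>R (S w + c *\<^sub>R w)"
    unfolding u_def using w' S_scaleR w by (simp add: S_S)
  then have "u + c *\<^sub>R S u = (1 / (1 + c\<^sup>2)) *\<^sub>R ((1 + c\<^sup>2) *\<^sub>R w)"
    by (simp add: u_def algebra_simps power2_eq_square)
  moreover have "1 + c\<^sup>2 \<noteq> 0" by (smt (verit) zero_le_power2)
  ultimately have uw: "u + c *\<^sub>R S u = w" by simp
  obtain F where F: "F \<in> commuting_operators D S" "finite_rank F"
    "\<And>y. F y = L (0, y) *\<^sub>R u + L (y, 0) *\<^sub>R S u"
    using annihilator_operator[OF L(1,2) u] by metis
  have "F b = 0" if "b \<in> span B" for b
    using linear_eq_0_on_span[OF bounded_linear.linear[OF blinfun.bounded_linear_right] _ that, of F]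
      L(3,4) F(3) by simp
  moreover have "F x = w" using F(3) L(5) uw by (simp add: c_def)
  ultimately show thesis using that F(1,2) by blast
qed

lemma commuting_add:
  assumes "F \<in> commuting_operators D S" "G \<in> commuting_operators D S"
  shows "F + G \<in> commuting_operators D S"
  using assms D_subspace by (auto simp: commuting_operators_def blinfun.add_left S_add subspace_add)

lemma commuting_zero: "0 \<in> commuting_operators D S"
  using subspace_0[OF D_subspace] S_scaleR[of 0 0] by (simp add: commuting_operators_def)

text \<open>
  Exact agreement on \<open>D \<inter> span B\<close> is there for the induction: at a new point \<open>b + S d\<close> with \<open>d\<close> in
  this space, \<open>S\<close> could magnify any error at \<open>d\<close>.
\<close>

lemma finite_rank_approximation:
  assumes T: "T \<in> commuting_operators D S" and "finite B" "0 < e"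
  shows "\<exists>F \<in> commuting_operators D S. finite_rank F \<and>
    (\<forall>b\<in>B. norm (F b - T b) < e) \<and> (\<forall>y \<in> D \<inter> span B. F y = T y)"
  using \<open>finite B\<close> \<open>0 < e\<close>
proof (induction arbitrary: e)
  case empty
  show ?case
    by (rule bexI[of _ 0]) (auto simp: commuting_zero finite_rank_zero blinfun.zero_right)
next
  case (insert x B)
  have lin: "linear (\<lambda>y. F y - T y)" for F :: "'a \<Rightarrow>\<^sub>L 'a"
    by (intro bounded_linear.linear bounded_linear_sub blinfun.bounded_linear_right)
  \<comment> \<open>The induction hypothesis allows one further point \<open>z\<close> of the span to be controlled, at the
    price of a smaller tolerance on \<open>B\<close>.\<close>
  have IH: "\<exists>F \<in> commuting_operators D S. finite_rank F \<and> (\<forall>b\<in>B. norm (F b - T b) < e) \<and>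
      norm (F z - T z) < e \<and> (\<forall>y \<in> D \<inter> span B. F y = T y)" if z: "z \<in> span B" for z
  proof -
    obtain K where K: "0 \<le> K" "\<And>(f :: 'a \<Rightarrow> 'a) e. linear f \<Longrightarrow>
        (\<And>b. b \<in> B \<Longrightarrow> norm (f b) \<le> e) \<Longrightarrow> norm (f z) \<le> K * e"
      using linear_bound_on_span[OF z] by metis
    have "0 < e / (K + 1)" using K(1) insert.prems by simp
    from insert.IH[OF this] obtain F where F: "F \<in> commuting_operators D S" "finite_rank F"
      "\<And>b. b \<in> B \<Longrightarrow> norm (F b - T b) < e / (K + 1)" "\<forall>y \<in> D \<inter> span B. F y = T y"
      by blast
    have "norm (F z - T z) \<le> K * (e / (K + 1))"
      using F(3) by (intro K(2)[OF lin]) (auto intro: less_imp_le)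
    also have "\<dots> < e" using K(1) insert.prems by (simp add: field_simps)
    finally have "norm (F z - T z) < e" .
    moreover have "e / (K + 1) \<le> e" using K(1) insert.prems by (simp add: field_simps)
    ultimately show ?thesis using F by (intro bexI[of _ F]) (auto intro: less_le_trans)
  qed
  show ?case
  proof (cases "\<exists>b\<in>span B. \<exists>d\<in>D \<inter> span B. x = b + S d")
    case True
    \<comment> \<open>The value at \<open>x\<close> is already determined, and correct up to the error at \<open>b\<close>. Nothing is added.\<close>
    then obtain b d where bd: "b \<in> span B" "d \<in> D" "d \<in> span B" "x = b + S d" by blast
    obtain F where F: "F \<in> commuting_operators D S" "finite_rank F"
      "\<forall>b\<in>B. norm (F b - T b) < e" "norm (F b - T b) < e" "\<forall>y \<in> D \<inter> span B. F y = T y"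
      using IH[OF bd(1)] by blast
    have Sd: "F (S d) = T (S d)"
      using F(1,5) T bd(2,3) by (simp add: commuting_operators_def)
    have "F y = T y" if y: "y \<in> D" "y \<in> span (insert x B)" for y
    proof -
      obtain k where "y - k *\<^sub>R x \<in> span B" using y(2) by (auto simp: span_breakdown_eq)
      then have "(y - k *\<^sub>R x) + k *\<^sub>R b \<in> span B" using bd(1) by (intro span_add span_scale)
      then have "y - k *\<^sub>R S d \<in> span B" by (simp add: bd(4) algebra_simps)
      moreover have "y - k *\<^sub>R S d \<in> D"
        using y(1) bd(2) D_subspace S_in_D by (intro subspace_diff subspace_scale)
      ultimately have "F (y - k *\<^sub>R S d) = T (y - k *\<^sub>R S d)" using F(5) by blast
      then show ?thesis using Sd by (simp add: blinfun.diff_right blinfun.scaleR_right)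
    qed
    moreover have "norm (F x - T x) < e" using F(4) Sd by (simp add: bd(4) blinfun.add_right)
    ultimately show ?thesis using F(1,2,3) by (intro bexI[of _ F]) auto
  next
    case False
    then have x: "x \<noteq> b + S d" if "b \<in> span B" "d \<in> D \<inter> span B" for b d using that by blast
    show ?thesis
    proof (cases "\<exists>y\<in>D. y - x \<in> span B")
      case True
      \<comment> \<open>Modulo \<open>D \<inter> span B\<close>, the space \<open>D \<inter> span (insert x B)\<close> is spanned by \<open>y\<close>. The correction is
        chosen so that the value at \<open>y\<close> becomes exact; the error at \<open>x\<close> is then the one at \<open>y - x\<close>.\<close>
      then obtain y where y: "y \<in> D" "y - x \<in> span B" by blast
      obtain F where F: "F \<in> commuting_operators D S" "finite_rank F"
        "\<forall>b\<in>B. norm (F b - T b) < e" "norm (F (y - x) - T (y - x)) < e"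
        "\<forall>y \<in> D \<inter> span B. F y = T y"
        using IH[OF y(2)] by blast
      have "T y - F y \<in> D"
        using F(1) T y(1) D_subspace by (auto simp: commuting_operators_def intro: subspace_diff)
      from operator_prescribed_at_point[OF insert.hyps(1) x this]
      obtain G where G: "G \<in> commuting_operators D S" "finite_rank G" "G x = T y - F y"
        "\<And>b. b \<in> span B \<Longrightarrow> G b = 0" by metis
      have Gy: "G y = T y - F y" using G(3) G(4)[OF y(2)] by (simp add: blinfun.diff_right)
      have "(F + G) z = T z" if z: "z \<in> D" "z \<in> span (insert x B)" for z
      proof -
        obtain k where k: "z - k *\<^sub>R x \<in> span B" using z(2) by (auto simp: span_breakdown_eq)
        have "(z - k *\<^sub>R x) - k *\<^sub>R (y - x) \<in> span B"
          by (rule span_diff[OF k span_scale[OF y(2)]])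
        then have sp: "z - k *\<^sub>R y \<in> span B" by (simp add: algebra_simps)
        have "z - k *\<^sub>R y \<in> D" using z(1) y(1) D_subspace by (intro subspace_diff subspace_scale)
        then have "(F + G) (z - k *\<^sub>R y) = T (z - k *\<^sub>R y)"
          using F(5) G(4)[OF sp] sp by (simp add: blinfun.add_left)
        moreover have "(F + G) y = T y" using Gy by (simp add: blinfun.add_left)
        ultimately show ?thesis by (simp add: blinfun.diff_right blinfun.scaleR_right)
      qed
      moreover have "norm ((F + G) x - T x) < e"
      proof -
        have "(F + G) x - T x = - (F (y - x) - T (y - x))"
          by (simp add: blinfun.add_left blinfun.diff_right G(3))
        then show ?thesis using F(4) by (simp add: norm_minus_commute)
      qed
      moreover have "norm ((F + G) b - T b) < e" if "b \<in> B" for b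
        using F(3) G(4)[OF span_base[OF that]] that by (simp add: blinfun.add_left)
      ultimately show ?thesis
        using commuting_add[OF F(1) G(1)] finite_rank_add[OF F(2) G(2)]
        by (intro bexI[of _ "F + G"]) auto
    next
      case no: False
      \<comment> \<open>Here \<open>D \<inter> span (insert x B) = D \<inter> span B\<close>, so only the approximation at \<open>x\<close> matters and
        density of \<open>D\<close> provides a value.\<close>
      obtain F where F: "F \<in> commuting_operators D S" "finite_rank F"
        "\<forall>b\<in>B. norm (F b - T b) < e" "\<forall>y \<in> D \<inter> span B. F y = T y"
        using IH[OF span_zero] by blast
      obtain w where w: "w \<in> D" "dist w (T x - F x) < e"
        using D_dense insert.prems closure_approachable[of "T x - F x" D] by auto
      from operator_prescribed_at_point[OF insert.hyps(1) x w(1)]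
      obtain G where G: "G \<in> commuting_operators D S" "finite_rank G" "G x = w"
        "\<And>b. b \<in> span B \<Longrightarrow> G b = 0" by metis
      have "(F + G) z = T z" if z: "z \<in> D" "z \<in> span (insert x B)" for z
      proof -
        obtain k where k: "z - k *\<^sub>R x \<in> span B" using z(2) by (auto simp: span_breakdown_eq)
        have "k = 0"
        proof (rule ccontr)
          assume "k \<noteq> 0"
          then have "(1/k) *\<^sub>R z - x = (1/k) *\<^sub>R (z - k *\<^sub>R x)" by (simp add: scaleR_diff_right)
          then have "(1/k) *\<^sub>R z - x \<in> span B" using span_scale[OF k, of "1/k"] by simp
          then show False using no z(1) D_subspace subspace_scale by blast
        qed
        then show ?thesis using k F(4) G(4) z(1) by (simp add: blinfun.add_left)
      qed
      moreover have "norm ((F + G) x - T x) < e"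
        using w(2) by (simp add: blinfun.add_left G(3) dist_norm algebra_simps)
      moreover have "norm ((F + G) b - T b) < e" if "b \<in> B" for b
        using F(3) G(4)[OF span_base[OF that]] that by (simp add: blinfun.add_left)
      ultimately show ?thesis
        using commuting_add[OF F(1) G(1)] finite_rank_add[OF F(2) G(2)]
        by (intro bexI[of _ "F + G"]) auto
    qed
  qed
qed

end

lemma closed_partial_complex_structureI:
  assumes S: "partial_complex_structure D S" and closed: "closed_operator D S"
  shows "closed_partial_complex_structure D S"
proof
  have inj: "inj_on S D" and onto: "S ` D = D" and the_inv: "\<And>x. x \<in> D \<Longrightarrow> the_inv_into D S x = - S x"
    and lin: "partial_linear_operator D S"
    using S by (auto simp: partial_complex_structure_def)
  show "closure D = UNIV" using S by (simp add: partial_complex_structure_def)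
  show D: "subspace D" using lin by (simp add: partial_linear_operator_def)
  show "S (x + y) = S x + S y" if "x \<in> D" "y \<in> D" for x y
    using lin that by (simp add: partial_linear_operator_def)
  show scale: "S (c *\<^sub>R x) = c *\<^sub>R S x" if "x \<in> D" for c x
    using lin that by (simp add: partial_linear_operator_def)
  show in_D: "S x \<in> D" if "x \<in> D" for x using onto that by blast
  show "S (S x) = - x" if x: "x \<in> D" for x
  proof -
    have "x = - S (S x)"
      using the_inv[OF in_D[OF x]] the_inv_into_f_f[OF inj x] by simp
    then show ?thesis by (metis minus_minus)
  qed
  have "(\<lambda>x. (x, S x)) ` D = {(x, S x) |x. x \<in> D}" by auto
  then show "closed ((\<lambda>x. (x, S x)) ` D)" using closed by (simp add: closed_operator_def)
qed

theorem theorem3p5: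
  fixes D :: "'a::banach set" and S :: "'a \<Rightarrow> 'a"
  assumes "\<not> finite_dimensional (UNIV :: 'a set)"
    and "partial_complex_structure D S"
    and "closed_operator D S"
  shows "dense_in_topology
           (subtopology strong_operator_topology (commuting_operators D S))
           {T \<in> commuting_operators D S. finite_rank T}"
proof -
  interpret closed_partial_complex_structure D S
    by (rule closed_partial_complex_structureI[OF assms(2,3)])
  let ?A = "commuting_operators D S"
  let ?X = "subtopology strong_operator_topology ?A"
  have topspace: "topspace ?X = ?A" by (simp add: strong_operator_topology_topspace)
  have "T \<in> ?X closure_of {T \<in> ?A. finite_rank T}" if T: "T \<in> ?A" for T
    unfolding in_closure_of topspace
  proof (intro conjI allI impI)
    fix W assume "T \<in> W \<and> openin ?X W"
    then obtain U where U: "openin strong_operator_topology U" "W = U \<inter> ?A" "T \<in> U"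
      by (auto simp: openin_subtopology)
    obtain B e where B: "finite B" "0 < e"
      "\<And>F. (\<And>b. b \<in> B \<Longrightarrow> norm (blinfun_apply F b - blinfun_apply T b) < e) \<Longrightarrow> F \<in> U"
      using strong_operator_neighbourhood[OF U(1,3)] by metis
    obtain F where "F \<in> ?A" "finite_rank F" "\<forall>b\<in>B. norm (F b - T b) < e"
      using finite_rank_approximation[OF T B(1,2)] by blast
    then show "\<exists>F. F \<in> {T \<in> ?A. finite_rank T} \<and> F \<in> W" using B(3)[of F] U(2) by auto
  qed (rule T)
  moreover have "?X closure_of {T \<in> ?A. finite_rank T} \<subseteq> ?A"
    using closure_of_subset_topspace[of ?X] topspace by blast
  ultimately show ?thesis unfolding dense_in_topology_def topspace by auto
qed

end
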